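(* Let $G$ be a finite cyclic group, let $N \trianglelefteq G$, and let $\mathrm{C}_G$ and $\mathrm{C}_{G/N}$ be circulant graphs on $G$ and $G/N$ such that the quotient map $\psi : G \to G/N$ is a covering map $\psi : \mathrm{C}_G \to \mathrm{C}_{G/N}$. Then the covering map $\psi$ is $|N|$-fold.
   Context: Given a group $G$ and a generating set $S \subset G$ with $1 \notin S$ and $S = S^{-1}$, the (undirected) Cayley graph of $(G,S)$ has vertex set $G$, and $(g,g')$ is an edge if and only if $g' = gs$ for some $s \in S$. All graphs are assumed finite, connected, without loops and without multiple edges. If $G$ is a cyclic group, a Cayley graph of $G$ on some connection set $S$ is called a circulant graph and is denoted $\mathrm{C}_G$. A graph homomorphism $\psi : X \to Y$ is a map $V(X) \to V(Y)$ such that $(u,v) \in E(X)$ implies $(\psi(u),\psi(v)) \in E(Y)$. A covering map (in this paper) is a surjective graph homomorphism; it is called $n$-fold if it is $n$-to-one on vertices, i.e. every vertex of $Y$ has exactly $n$ preimages. *)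

theory Defs
  imports "HOL-Algebra.Elementary_Groups" "Graph_Theory.Pair_Digraph" "Graph_Theory.Digraph_Component"
begin

definition connection_set :: "('a, 'm) monoid_scheme \<Rightarrow> 'a set \<Rightarrow> bool" where
  "connection_set G S \<longleftrightarrow>
     S \<subseteq> carrier G \<and> \<one>\<^bsub>G\<^esub> \<notin> S \<and> set_inv\<^bsub>G\<^esub> S = S \<and> generate G S = carrier G"

text \<open>
  Undirected simple graphs are symmetric loopless digraphs whose arcs are pairs of vertices
  (locale \<^locale>\<open>pair_graph\<close>).
\<close>

definition cayley_graph :: "('a, 'm) monoid_scheme \<Rightarrow> 'a set \<Rightarrow> 'a pair_pre_digraph" where
  "cayley_graph G S =
     \<lparr> pverts = carrier G,
       parcs = {(g, g'). g \<in> carrier G \<and> g' \<in> carrier G \<and> (\<exists>s\<in>S. g' = g \<otimes>\<^bsub>G\<^esub> s)} \<rparr>"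

definition circulant_graph :: "('a, 'm) monoid_scheme \<Rightarrow> 'a pair_pre_digraph \<Rightarrow> bool" where
  "circulant_graph G X \<longleftrightarrow>
     cyclic_group G \<and> (\<exists>S. connection_set G S \<and> X = cayley_graph G S)"

definition graph_hom :: "'a pair_pre_digraph \<Rightarrow> 'b pair_pre_digraph \<Rightarrow> ('a \<Rightarrow> 'b) \<Rightarrow> bool" where
  "graph_hom X Y f \<longleftrightarrow>
     f \<in> pverts X \<rightarrow> pverts Y \<and> (\<forall>u v. (u, v) \<in> parcs X \<longrightarrow> (f u, f v) \<in> parcs Y)"

text \<open>Surjectivity is on vertices; no local bijectivity is required.\<close>

definition covering_map :: "'a pair_pre_digraph \<Rightarrow> 'b pair_pre_digraph \<Rightarrow> ('a \<Rightarrow> 'b) \<Rightarrow> bool" where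
  "covering_map X Y f \<longleftrightarrow> graph_hom X Y f \<and> f ` pverts X = pverts Y"

definition n_fold_covering_map ::
  "nat \<Rightarrow> 'a pair_pre_digraph \<Rightarrow> 'b pair_pre_digraph \<Rightarrow> ('a \<Rightarrow> 'b) \<Rightarrow> bool" where
  "n_fold_covering_map n X Y f \<longleftrightarrow>
     covering_map X Y f \<and>
     (\<forall>y\<in>pverts Y. finite {x \<in> pverts X. f x = y} \<and> card {x \<in> pverts X. f x = y} = n)"

text \<open>
  The standing convention that graphs are finite, connected, without loops and without multiple
  edges holds for the Cayley graphs of a finite group.
\<close>

lemma pair_graph_cayley_graph:
  fixes G (structure)
  assumes "Group.group G" "finite (carrier G)" "connection_set G S"
  shows "pair_graph (cayley_graph G S)"
proof -
  interpret Group.group G by fact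
  have S: "S \<subseteq> carrier G" "\<one> \<notin> S" and inv: "\<And>s. s \<in> S \<Longrightarrow> inv s \<in> S"
    using assms(3) by (auto simp: connection_set_def SET_INV_def)
  have "finite (parcs (cayley_graph G S))"
    by (rule finite_subset[of _ "carrier G \<times> carrier G"])
      (auto simp: cayley_graph_def assms(2))
  moreover have "\<exists>t\<in>S. g = g \<otimes> s \<otimes> t" if "g \<in> carrier G" "s \<in> S" for g s
    using that S inv[of s] by (intro bexI[of _ "inv s"]) (auto simp: m_assoc subset_iff)
  then have "Digraph.symmetric (with_proj (cayley_graph G S))"
    by (auto simp: symmetric_def cayley_graph_def sym_def)
  moreover have "g \<noteq> g \<otimes> s" if "g \<in> carrier G" "s \<in> S" for g s
    using that S r_cancel_one'[of g s] by auto
  ultimately show ?thesis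
    by unfold_locales (auto simp: cayley_graph_def assms(2))
qed

lemma connected_cayley_graph:
  fixes G (structure)
  assumes "Group.group G" "finite (carrier G)" "connection_set G S"
  shows "Digraph_Component.connected (with_proj (cayley_graph G S))"
proof -
  interpret Group.group G by fact
  interpret X: pair_graph "cayley_graph G S"
    using assms by (rule pair_graph_cayley_graph)
  let ?R = "reachable (with_proj (cayley_graph G S))"
  have S: "S \<subseteq> carrier G" "generate G S = carrier G" and S_inv: "\<And>s. s \<in> S \<Longrightarrow> inv s \<in> S"
    using assms(3) by (auto simp: connection_set_def SET_INV_def)
  have [simp]: "pverts (cayley_graph G S) = carrier G"
    by (simp add: cayley_graph_def)
  have step: "?R g (g \<otimes> s)" if "g \<in> carrier G" "s \<in> S" for g s
    using that S by (intro X.reachable_adjI) (auto simp: cayley_graph_def)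
  have reach: "?R g (g \<otimes> h)" if "h \<in> generate G S" "g \<in> carrier G" for g h
    using that
  proof (induction arbitrary: g)
    case one
    then show ?case by simp
  next
    case (incl h)
    then show ?case by (simp add: step)
  next
    case (inv h)
    then show ?case by (simp add: step S_inv)
  next
    case (eng h1 h2)
    then have "h1 \<in> carrier G" "h2 \<in> carrier G" using S by auto
    then show ?case
      using eng.IH(1)[of g] eng.IH(2)[of "g \<otimes> h1"] eng.prems
      by (auto simp: m_assoc intro: X.reachable_trans)
  qed
  have "?R u v" if "u \<in> carrier G" "v \<in> carrier G" for u v
    using reach[of "inv u \<otimes> v" u] that S by (simp flip: m_assoc)
  then show ?thesis
    using X.reachable_mk_symmetric_eq[OF X.sym_arcs]
    by (auto simp: connected_def strongly_connected_def)
qed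

end

theory Submission
  imports Defs
begin

text \<open>The vertices of the quotient graph are the cosets of \<open>N\<close>. The fibre of the
  quotient map over a coset is that coset itself, viewed as a subset of \<open>G\<close>
  (\<open>rcoset_fibre\<close>), and translation puts it in bijection with \<open>N\<close>. So
  every fibre has \<open>card N\<close> elements.\<close>

text \<open>Right cosets partition the group: an element lies in the coset it generates, and any
  element of a coset represents that coset.\<close>

lemma (in Group.group) rcoset_fibre:
  assumes "subgroup N G" "K \<in> rcosets N"
  shows "{x \<in> carrier G. N #> x = K} = K"
proof -
  from assms(2) obtain a where a: "a \<in> carrier G" "K = N #> a"
    by (auto simp: RCOSETS_def)
  have "x \<in> carrier G \<and> N #> x = K \<longleftrightarrow> x \<in> K" for x
  proof
    assume "x \<in> carrier G \<and> N #> x = K"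
    then show "x \<in> K" using rcos_self assms(1) by blast
  next
    assume "x \<in> K"
    then show "x \<in> carrier G \<and> N #> x = K"
      using a assms(1) repr_independence r_coset_subset_G[OF subgroup.subset] by blast
  qed
  then show ?thesis by blast
qed

theorem corollary25:
  fixes G :: "('a, 'm) monoid_scheme" (structure)
    and N :: "'a set"
    and C_G :: "'a pair_pre_digraph"
    and C_GN :: "'a set pair_pre_digraph"
  assumes "Group.group G"
    and "finite (carrier G)"
    and "cyclic_group G"
    and "N \<lhd> G"
    and "circulant_graph G C_G"
    and "circulant_graph (G Mod N) C_GN"
    and "covering_map C_G C_GN (\<lambda>g. N #> g)"
  shows "n_fold_covering_map (card N) C_G C_GN (\<lambda>g. N #> g)"
proof -
  interpret Group.group G by fact
  have N: "subgroup N G"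
    using assms(4) by (rule normal_imp_subgroup)
  have verts: "pverts C_G = carrier G" "pverts C_GN = rcosets N"
    using assms(5,6) by (auto simp: circulant_graph_def cayley_graph_def FactGroup_def)
  \<comment> \<open>\<open>n_fold_covering_map\<close> asks for finiteness separately, as
    \<open>card\<close> is 0 on infinite sets; here a coset is a subset of the finite
    carrier.\<close>
  have "finite K \<and> card K = card N" if "K \<in> rcosets N" for K
    using that assms(2) rcosets_subset_PowG[OF N] card_rcosets_equal[OF that subgroup.subset[OF N]]
    by (auto dest: finite_subset)
  then show ?thesis
    using assms(7) by (simp add: n_fold_covering_map_def verts rcoset_fibre[OF N])
qed

end
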